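(* For $n\ge2$, the restriction of $f$ to $\overline{\mathrm{NC}}^{\mathrm{NN}}(n)$ is a bijection $f:\overline{\mathrm{NC}}^{\mathrm{NN}}(n)\to\mathrm{CT}_D(n)$.
   Context: $[n]=\{1,\dots,n\}$. An edge of a partition of $[n]$ is a pair $(i,j)$, $i<j$, in the same block with no element of that block strictly between. $\mathrm{NC}(n)$: partitions of $[n]$ with no two edges $(a,b),(c,d)$, $a<c<b<d$. A block $B$ is nonnested if no edge $(i,j)$ has $i<\min B\le\max B<j$. $\mathrm{NC}^{\mathrm{NN}}(n)$ is the set of pairs $(\sigma,X)$ with $\sigma\in\mathrm{NC}(n)$ and $X$ a set of nonnested blocks of $\sigma$; $\overline{\mathrm{NC}}^{\mathrm{NN}}(n)$ is the subset of those pairs such that any block $A\in X$ containing $n$ has $|A|\ge2$. Tableaux. A Ferrers diagram is a left-justified arrangement of cells with weakly decreasing row lengths from top to bottom, rows and columns possibly empty; its length is the number of rows plus columns. Traverse its southeast boundary from the northeast corner to the southwest corner, labelling the steps $1,\dots,n$; each step is a south step (right end of a row; the row gets the label) or a west step (bottom of a column; the column gets the label). If $F$ has $k$ columns, the shifted diagram $\overline F$ adds above $F$ new left-justified rows of lengths $1,2,\dots,k$ from top to bottom; the rightmost cell of a new row is its diagonal cell, and a new row whose diagonal cell lies in the column labelled $i$ is labelled $-i$. The $(i,j)$-entry is the cell in row $i$, column $j$. A permutation tableau of type $B_n$ is a $0,1$-filling of $\overline F$, $F$ of length $n$, such that (1) each column has at least one $1$; (2) no $0$ has both a $1$ above it in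 its column and a $1$ to its left in its row; (3) no $0$ in a diagonal cell has a $1$ to its left in its row. $\mathrm{CT}_B(n)$: those with exactly one $1$ in each column. $\mathrm{CT}_D(n)$: those $T\in\mathrm{CT}_B(n)$ such that, if the last (bottom) row of $\overline F$ is nonempty, the leftmost column does not have its $1$ in its topmost cell. The map $f$. For $(\sigma,X)\in\mathrm{NC}^{\mathrm{NN}}(n)$, let $F$ be the Ferrers diagram of length $n$ whose $i$-th boundary step is south iff $i$ is the minimum of a block of $\sigma$ not in $X$. Fill $\overline F$: for each $i$ that is the minimum of a block in $X$, put $1$ in the $(-i,i)$-entry; for distinct $i,j$ in a common block $B$ with $i=\min B$, put $1$ in the $(-i,j)$-entry if $B\in X$ and in the $(i,j)$-entry otherwise; all other cells $0$. This is $f(\sigma,X)$. *)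

theory Defs
  imports Main "HOL-Library.FuncSet" "HOL-Library.Disjoint_Sets"
begin

definition edge :: "nat set set \<Rightarrow> nat \<Rightarrow> nat \<Rightarrow> bool" where
  "edge \<sigma> i j \<longleftrightarrow> i < j \<and> (\<exists>B\<in>\<sigma>. i \<in> B \<and> j \<in> B \<and> (\<forall>l\<in>B. \<not> (i < l \<and> l < j)))"

definition NC :: "nat \<Rightarrow> nat set set set" where
  "NC n = {\<sigma>. partition_on {1..n} \<sigma> \<and>
     \<not> (\<exists>a b c d. edge \<sigma> a b \<and> edge \<sigma> c d \<and> a < c \<and> c < b \<and> b < d)}"

definition nonnested :: "nat set set \<Rightarrow> nat set \<Rightarrow> bool" where
  "nonnested \<sigma> B \<longleftrightarrow> \<not> (\<exists>i j. edge \<sigma> i j \<and> i < Min B \<and> Max B < j)"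

definition NC_NN :: "nat \<Rightarrow> (nat set set \<times> nat set set) set" where
  "NC_NN n = {(\<sigma>, X). \<sigma> \<in> NC n \<and> X \<subseteq> {B \<in> \<sigma>. nonnested \<sigma> B}}"

definition NC_NN_bar :: "nat \<Rightarrow> (nat set set \<times> nat set set) set" where
  "NC_NN_bar n = {(\<sigma>, X) \<in> NC_NN n. \<forall>A\<in>X. n \<in> A \<longrightarrow> card A \<ge> 2}"

text \<open>Ferrers diagrams. The number of columns is recorded separately from the row lengths
  because columns may be empty; the entries of the list are the lengths of the rows from top to
  bottom, and may be 0. Rows are indexed from the top and columns from the left, both starting
  with 0.\<close>

record ferrers =
  ncols :: nat
  row_lens :: "nat list"

definition nrows :: "ferrers \<Rightarrow> nat" where
  "nrows F = length (row_lens F)"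

definition is_ferrers :: "ferrers \<Rightarrow> bool" where
  "is_ferrers F \<longleftrightarrow> sorted_wrt (\<ge>) (row_lens F) \<and> (\<forall>l\<in>set (row_lens F). l \<le> ncols F)"

definition ferrers_length :: "ferrers \<Rightarrow> nat" where
  "ferrers_length F = nrows F + ncols F"

text \<open>The label of a boundary step is the number of steps walked from the northeast corner,
  this step included. The south step at the right end of row \<open>r\<close> is preceded by the \<open>r\<close> south
  steps of the rows above it and by one west step for each column that row \<open>r\<close> does not reach.
  The west step at the bottom of column \<open>c\<close> is preceded by the south steps of the rows meeting
  that column and by the west steps of the columns to its right.\<close>

definition row_label :: "ferrers \<Rightarrow> nat \<Rightarrow> nat" where
  "row_label F r = r + (ncols F - row_lens F ! r) + 1"

definition col_label :: "ferrers \<Rightarrow> nat \<Rightarrow> nat" where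
  "col_label F c = card {r. r < nrows F \<and> c < row_lens F ! r} + (ncols F - Suc c) + 1"

definition south_step :: "ferrers \<Rightarrow> nat \<Rightarrow> bool" where
  "south_step F i \<longleftrightarrow> (\<exists>r<nrows F. row_label F r = i)"

text \<open>A Ferrers diagram is determined by its length and the set of its south steps.\<close>

lemma row_label_le:
  assumes "is_ferrers F" "r < nrows F"
  shows "1 \<le> row_label F r" "row_label F r \<le> ferrers_length F"
  using assms by (auto simp: row_label_def ferrers_length_def)

lemma row_label_strict_mono:
  assumes "is_ferrers F" "r < r'" "r' < nrows F"
  shows "row_label F r < row_label F r'"
proof -
  have "row_lens F ! r' \<le> row_lens F ! r"
    using assms by (auto simp: is_ferrers_def nrows_def sorted_wrt_iff_nth_less)
  then show ?thesis using assms(2) by (simp add: row_label_def)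
qed

lemma row_labels_eq:
  assumes "is_ferrers F"
  shows "map (row_label F) [0..<nrows F] = sorted_list_of_set {i. south_step F i}"
proof -
  have *: "sorted_wrt (<) (map (row_label F) [0..<nrows F])"
    using row_label_strict_mono[OF assms] by (auto simp: sorted_wrt_iff_nth_less)
  have "set (map (row_label F) [0..<nrows F]) = {i. south_step F i}"
    by (auto simp: south_step_def)
  with * show ?thesis
    by (metis strict_sorted_iff sorted_list_of_set.idem_if_sorted_distinct)
qed

lemma ferrers_ex1:
  assumes "S \<subseteq> {1..n}"
  shows "\<exists>!F. is_ferrers F \<and> ferrers_length F = n \<and>
    (\<forall>i\<in>{1..n}. south_step F i \<longleftrightarrow> i \<in> S)"
proof (rule ex_ex1I)
  define s where "s = sorted_list_of_set S"
  have fin: "finite S" using assms finite_subset by blast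
  define m where "m = length s"
  have m: "m = card S" by (simp add: m_def s_def)
  have mn: "m \<le> n" using card_mono[OF _ assms] by (simp add: m)
  have sS: "set s = S" using fin by (simp add: s_def)
  have str: "s ! r < s ! r'" if "r < r'" "r' < m" for r r'
    using strict_sorted_list_of_set[of S] that
    by (auto simp: sorted_wrt_iff_nth_less s_def m_def)
  have mem: "s ! r \<in> {1..n}" if "r < m" for r
    using that assms sS m_def nth_mem by blast
  have lo: "r + 1 \<le> s ! r" if "r < m" for r
    using that
  proof (induction r)
    case 0 then show ?case using mem[of 0] by simp
  next
    case (Suc r) then show ?case using str[of r "Suc r"] by simp
  qed
  have hi: "s ! (m - Suc d) + d \<le> n" if "d < m" for d
    using that
  proof (induction d)
    case 0 then show ?case using mem[of "m - 1"] by simp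
  next
    case (Suc d)
    then have "m - Suc (Suc d) < m - Suc d" "m - Suc d < m" by linarith+
    then have "s ! (m - Suc (Suc d)) < s ! (m - Suc d)" by (rule str)
    then show ?case using Suc by simp
  qed
  have hi': "s ! r \<le> n - m + r + 1" if "r < m" for r
    using hi[of "m - Suc r"] that mn by simp
  define F where
    "F = \<lparr>ncols = n - m, row_lens = map (\<lambda>r. n - m + r + 1 - s ! r) [0..<m]\<rparr>"
  have nr: "nrows F = m" by (simp add: F_def nrows_def)
  have rl: "row_label F r = s ! r" if "r < m" for r
    using lo[OF that] hi'[OF that] that by (simp add: row_label_def F_def)
  have dec: "n - m + r' + 1 - s ! r' \<le> n - m + r + 1 - s ! r" if "r < r'" "r' < m" for r r'
    using that
  proof (induction r' rule: less_induct)
    case (less q)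
    then obtain p where q: "q = Suc p" by (cases q) auto
    have 1: "n - m + q + 1 - s ! q \<le> n - m + p + 1 - s ! p"
      using str[of p q] less.prems q by simp
    show ?case
    proof (cases "r = p")
      case True then show ?thesis using 1 by simp
    next
      case False
      then have "n - m + p + 1 - s ! p \<le> n - m + r + 1 - s ! r"
        using less.IH[of p] less.prems q by simp
      with 1 show ?thesis by linarith
    qed
  qed
  have "is_ferrers F"
    unfolding is_ferrers_def
  proof
    show "sorted_wrt (\<ge>) (row_lens F)"
      using dec by (auto simp: F_def sorted_wrt_iff_nth_less)
    show "\<forall>l\<in>set (row_lens F). l \<le> ncols F"
      using lo by (fastforce simp: F_def)
  qed
  moreover have "ferrers_length F = n" 
    using mn by (simp add: ferrers_length_def nr) (simp add: F_def)
  moreover have "south_step F i \<longleftrightarrow> i \<in> S" for i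
  proof -
    have "south_step F i \<longleftrightarrow> (\<exists>r<m. s ! r = i)"
      unfolding south_step_def nr using rl by metis
    also have "\<dots> \<longleftrightarrow> i \<in> S"
      unfolding sS[symmetric] in_set_conv_nth m_def by blast
    finally show ?thesis .
  qed
  ultimately show "\<exists>F. is_ferrers F \<and> ferrers_length F = n \<and>
      (\<forall>i\<in>{1..n}. south_step F i \<longleftrightarrow> i \<in> S)" by blast
next
  fix F G
  assume F: "is_ferrers F \<and> ferrers_length F = n \<and> (\<forall>i\<in>{1..n}. south_step F i \<longleftrightarrow> i \<in> S)"
  assume G: "is_ferrers G \<and> ferrers_length G = n \<and> (\<forall>i\<in>{1..n}. south_step G i \<longleftrightarrow> i \<in> S)"
  have S: "{i. south_step H i} = S"
    if "is_ferrers H \<and> ferrers_length H = n \<and> (\<forall>i\<in>{1..n}. south_step H i \<longleftrightarrow> i \<in> S)" for H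
    using that assms row_label_le[of H] unfolding south_step_def by fastforce
  have eq: "map (row_label F) [0..<nrows F] = map (row_label G) [0..<nrows G]"
    using row_labels_eq[of F] row_labels_eq[of G] S[OF F] S[OF G] F G by simp
  then have nr: "nrows F = nrows G"
    by (metis length_map length_upt minus_nat.diff_0)
  then have nc: "ncols F = ncols G"
    using F G by (simp add: ferrers_length_def)
  have "row_lens F ! r = row_lens G ! r" if "r < nrows F" for r
  proof -
    have "row_label F r = row_label G r"
      using arg_cong[OF eq, of "\<lambda>xs. xs ! r"] that nr by simp
    moreover have "row_lens F ! r \<le> ncols F" "row_lens G ! r \<le> ncols G"
      using F G that nr by (auto simp: is_ferrers_def nrows_def)
    ultimately show ?thesis using nc by (simp add: row_label_def)
  qed
  then have "row_lens F = row_lens G"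
    using nr by (intro nth_equalityI) (auto simp: nrows_def)
  then show "F = G" using nc by simp
qed

text \<open>The shifted diagram. Its rows \<open>r < ncols F\<close> are the new ones; the new row \<open>r\<close> has length
  \<open>r + 1\<close>, so that its diagonal cell is \<open>(r, r)\<close>.\<close>

definition shifted_row_lens :: "ferrers \<Rightarrow> nat list" where
  "shifted_row_lens F = [1..<Suc (ncols F)] @ row_lens F"

definition shifted_cells :: "ferrers \<Rightarrow> (nat \<times> nat) set" where
  "shifted_cells F =
     {(r, c). r < length (shifted_row_lens F) \<and> c < shifted_row_lens F ! r}"

definition diagonal_cells :: "ferrers \<Rightarrow> (nat \<times> nat) set" where
  "diagonal_cells F = {(r, r) | r. r < ncols F}"

definition shifted_row_label :: "ferrers \<Rightarrow> nat \<Rightarrow> int" where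
  "shifted_row_label F r =
     (if r < ncols F then - int (col_label F r) else int (row_label F (r - ncols F)))"

text \<open>A tableau is a Ferrers diagram \<open>F\<close> together with a filling of its shifted diagram.
  The diagram has to be recorded, since the cells do not determine the empty rows.\<close>

type_synonym tableau = "ferrers \<times> (nat \<times> nat \<Rightarrow> nat)"

definition perm_tableaux_B :: "nat \<Rightarrow> tableau set" where
  "perm_tableaux_B n = {(F, t).
     is_ferrers F \<and> ferrers_length F = n \<and>
     t \<in> shifted_cells F \<rightarrow>\<^sub>E {0, 1} \<and>
     (\<forall>c<ncols F. \<exists>r. (r, c) \<in> shifted_cells F \<and> t (r, c) = 1) \<and>
     (\<forall>(r, c) \<in> shifted_cells F. t (r, c) = 0 \<longrightarrow>
        \<not> ((\<exists>r'<r. (r', c) \<in> shifted_cells F \<and> t (r', c) = 1) \<and>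
           (\<exists>c'<c. (r, c') \<in> shifted_cells F \<and> t (r, c') = 1))) \<and>
     (\<forall>(r, c) \<in> diagonal_cells F. t (r, c) = 0 \<longrightarrow>
        \<not> (\<exists>c'<c. (r, c') \<in> shifted_cells F \<and> t (r, c') = 1))}"

definition CT_B :: "nat \<Rightarrow> tableau set" where
  "CT_B n = {(F, t) \<in> perm_tableaux_B n.
     \<forall>c<ncols F. \<exists>!r. (r, c) \<in> shifted_cells F \<and> t (r, c) = 1}"

text \<open>The leftmost column is column 0; its topmost cell is the only cell of the first new row.
  The first conjunct of the premise only matters for the empty diagram, which has no rows.\<close>

definition CT_D :: "nat \<Rightarrow> tableau set" where
  "CT_D n = {(F, t) \<in> CT_B n.
     shifted_row_lens F \<noteq> [] \<and> last (shifted_row_lens F) > 0 \<longrightarrow> t (0, 0) \<noteq> 1}"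

text \<open>Unique existence is lemma \<open>ferrers_ex1\<close>.\<close>

definition nc_diagram :: "nat \<Rightarrow> nat set set \<Rightarrow> nat set set \<Rightarrow> ferrers" where
  "nc_diagram n \<sigma> X = (THE F. is_ferrers F \<and> ferrers_length F = n \<and>
     (\<forall>i\<in>{1..n}. south_step F i \<longleftrightarrow> (\<exists>B\<in>\<sigma> - X. i = Min B)))"

text \<open>\<open>nc_one_entry \<sigma> X a j\<close>: the prescription puts a 1 in the cell in the row labelled \<open>a\<close>
  and the column labelled \<open>j\<close>.\<close>

definition nc_one_entry :: "nat set set \<Rightarrow> nat set set \<Rightarrow> int \<Rightarrow> nat \<Rightarrow> bool" where
  "nc_one_entry \<sigma> X a j \<longleftrightarrow>
     (\<exists>B\<in>X. j = Min B \<and> a = - int (Min B)) \<or>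
     (\<exists>B\<in>\<sigma>. j \<in> B \<and> j \<noteq> Min B \<and> a = (if B \<in> X then - int (Min B) else int (Min B)))"

definition nc_to_tableau :: "nat \<Rightarrow> nat set set \<times> nat set set \<Rightarrow> tableau" where
  "nc_to_tableau n = (\<lambda>(\<sigma>, X). let F = nc_diagram n \<sigma> X in
     (F, \<lambda>(r, c) \<in> shifted_cells F.
           if nc_one_entry \<sigma> X (shifted_row_label F r) (col_label F c) then 1 else 0))"

end

theory Submission imports Defs begin

text \<open>Both sides are encoded by pairs \<open>(S, m)\<close>: \<open>S\<close> is the set of south labels, that is, of minima
  of blocks outside \<open>X\<close>, and \<open>m j\<close> is the minimum of the block of \<open>j\<close>. On the tableau side, for
  \<open>j \<notin> S\<close>, \<open>m j\<close> is the absolute value of the label of the row holding the unique \<open>1\<close> of column \<open>j\<close>.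
  Every \<open>i\<close> in \<open>{1..n}\<close> labels exactly one row of the shifted diagram up to sign, the cells are
  the pairs with \<open>|row label| \<le> column label\<close>, and rows are ordered by their signed labels.
  Hence the diagonal condition says that \<open>m\<close> is idempotent, and the remaining tableau condition compares
  the signed labels of \<open>m j\<close> and \<open>m j'\<close> for \<open>j < j'\<close> with \<open>m j' \<le> j\<close>. The latter is equivalent to
  the partition being noncrossing and the blocks in \<open>X\<close> being nonnested. Finally, if \<open>n\<close> is a
  column label, then that column is the leftmost one, and its topmost cell carries a \<open>1\<close> iff \<open>{n} \<in> X\<close>.\<close>

section \<open>Labels of rows, columns and cells of the shifted diagram\<close>

definition south_labels :: "ferrers \<Rightarrow> nat set" where
  "south_labels F = {i. south_step F i}"

definition row_abs :: "ferrers \<Rightarrow> nat \<Rightarrow> nat" where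
  "row_abs F r = nat \<bar>shifted_row_label F r\<bar>"

text \<open>The row label with absolute value \<open>i\<close> when \<open>S\<close> is the set of
  south labels: positive for a row of the original diagram, negative for a new row, which takes its
  label from a column.\<close>

definition signed :: "nat set \<Rightarrow> nat \<Rightarrow> int" where
  "signed S i = (if i \<in> S then int i else - int i)"

lemma row_lens_antimono:
  assumes "is_ferrers F" "r \<le> r'" "r' < nrows F"
  shows "row_lens F ! r' \<le> row_lens F ! r"
  using assms by (cases "r = r'") (auto simp: is_ferrers_def nrows_def sorted_wrt_iff_nth_less)

lemma row_len_le_ncols:
  assumes "is_ferrers F" "r < nrows F"
  shows "row_lens F ! r \<le> ncols F"
  using assms by (auto simp: is_ferrers_def nrows_def)

text \<open>Rows \<open>0\<close> to \<open>r\<close> all reach column \<open>c\<close>, so at least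
  \<open>r + 1\<close> south steps precede the west step of that column. Every column beyond the end
  of row \<open>r\<close> also lies to the right of \<open>c\<close>.\<close>

lemma row_label_less_col_label:
  assumes "is_ferrers F" "r < nrows F" "c < row_lens F ! r"
  shows "row_label F r < col_label F c"
proof -
  have "{..r} \<subseteq> {q. q < nrows F \<and> c < row_lens F ! q}"
    using row_lens_antimono[OF assms(1) _ assms(2)] assms(2,3) by fastforce
  from card_mono[OF _ this] have "Suc r \<le> card {q. q < nrows F \<and> c < row_lens F ! q}" by simp
  then show ?thesis
    using assms(3) row_len_le_ncols[OF assms(1,2)] by (simp add: row_label_def col_label_def)
qed

text \<open>Row lengths decrease downwards, so only rows above \<open>r\<close> can reach column
  \<open>c\<close>; at most \<open>r\<close> south steps precede its west step.\<close>

lemma col_label_less_row_label: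
  assumes "is_ferrers F" "c < ncols F" "row_lens F ! r \<le> c"
  shows "col_label F c < row_label F r"
proof -
  have "{q. q < nrows F \<and> c < row_lens F ! q} \<subseteq> {..<r}"
  proof
    fix q assume q: "q \<in> {q. q < nrows F \<and> c < row_lens F ! q}"
    then show "q \<in> {..<r}"
      using row_lens_antimono[OF assms(1), of r q] assms(3) by (cases "r \<le> q") auto
  qed
  from card_mono[OF _ this] have "card {q. q < nrows F \<and> c < row_lens F ! q} \<le> r" by simp
  then show ?thesis using assms(2,3) by (simp add: row_label_def col_label_def)
qed

lemma cell_iff_row_label_less:
  assumes "is_ferrers F" "r < nrows F" "c < ncols F"
  shows "c < row_lens F ! r \<longleftrightarrow> row_label F r < col_label F c"
  using row_label_less_col_label[OF assms(1,2)] col_label_less_row_label[OF assms(1,3)]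
  by (meson linorder_not_less order_less_asym)

lemma col_label_neq_row_label:
  assumes "is_ferrers F" "r < nrows F" "c < ncols F"
  shows "col_label F c \<noteq> row_label F r"
  using row_label_less_col_label[OF assms(1,2)] col_label_less_row_label[OF assms(1,3)]
  by (metis linorder_not_less order_less_irrefl)

lemma col_label_strict_antimono:
  assumes "c < c'" "c' < ncols F"
  shows "col_label F c' < col_label F c"
proof -
  have "card {r. r < nrows F \<and> c' < row_lens F ! r} \<le> card {r. r < nrows F \<and> c < row_lens F ! r}"
    using assms by (intro card_mono) auto
  then show ?thesis using assms by (simp add: col_label_def)
qed

lemma col_label_less_iff:
  assumes "c < ncols F" "c' < ncols F"
  shows "col_label F c < col_label F c' \<longleftrightarrow> c' < c"
  using col_label_strict_antimono assms by (metis linorder_less_linear order_less_asym)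

lemma col_label_eq_iff:
  assumes "c < ncols F" "c' < ncols F"
  shows "col_label F c = col_label F c' \<longleftrightarrow> c = c'"
  using col_label_less_iff assms by (metis nat_neq_iff)

lemma south_labels_subset:
  assumes "is_ferrers F"
  shows "south_labels F \<subseteq> {1..ferrers_length F}"
  using row_label_le[OF assms] by (auto simp: south_labels_def south_step_def)

text \<open>A counting argument: the column labels are distinct and avoid the \<open>nrows F\<close>
  south labels, so they exhaust the \<open>ncols F\<close> labels that remain.\<close>

lemma col_label_image:
  assumes "is_ferrers F"
  shows "col_label F ` {..<ncols F} = {1..ferrers_length F} - south_labels F"
proof (rule card_subset_eq)
  have "card {r. r < nrows F \<and> c < row_lens F ! r} \<le> card {..<nrows F}" for c
    by (intro card_mono) auto
  then have *: "card {r. r < nrows F \<and> c < row_lens F ! r} \<le> nrows F" for c by simp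
  show "col_label F ` {..<ncols F} \<subseteq> {1..ferrers_length F} - south_labels F"
  proof
    fix j assume "j \<in> col_label F ` {..<ncols F}"
    then obtain c where c: "c < ncols F" "j = col_label F c" by auto
    then have "1 \<le> j" "j \<le> ferrers_length F"
      using *[of c] by (simp_all add: col_label_def ferrers_length_def)
    moreover have "j \<notin> south_labels F"
      using col_label_neq_row_label[OF assms _ c(1)] c(2)
      by (metis mem_Collect_eq south_labels_def south_step_def)
    ultimately show "j \<in> {1..ferrers_length F} - south_labels F" by simp
  qed
  have "inj_on (row_label F) {..<nrows F}"
    using row_label_strict_mono[OF assms] by (auto simp: inj_on_def) (metis linorder_less_linear order_less_irrefl)
  moreover have "south_labels F = row_label F ` {..<nrows F}"
    by (auto simp: south_labels_def south_step_def)
  ultimately have "card (south_labels F) = nrows F" by (simp add: card_image)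
  then have "card ({1..ferrers_length F} - south_labels F) = ncols F"
    using south_labels_subset[OF assms] by (simp add: card_Diff_subset finite_subset ferrers_length_def)
  moreover have "card (col_label F ` {..<ncols F}) = ncols F"
    using col_label_eq_iff by (subst card_image) (auto simp: inj_on_def)
  ultimately show "card (col_label F ` {..<ncols F}) = card ({1..ferrers_length F} - south_labels F)"
    by simp
qed auto

lemma col_label_mem:
  assumes "is_ferrers F" "c < ncols F"
  shows "col_label F c \<in> {1..ferrers_length F}" "col_label F c \<notin> south_labels F"
  using col_label_image[OF assms(1)] assms(2) by blast+

lemma ex_col_label:
  assumes "is_ferrers F" "j \<in> {1..ferrers_length F}" "j \<notin> south_labels F"
  obtains c where "c < ncols F" "col_label F c = j"
  using col_label_image[OF assms(1)] assms(2,3) by (metis DiffI imageE lessThan_iff)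

lemma length_shifted_row_lens: "length (shifted_row_lens F) = ferrers_length F"
  by (simp add: shifted_row_lens_def ferrers_length_def nrows_def)

lemma row_abs_eq:
  "row_abs F r = (if r < ncols F then col_label F r else row_label F (r - ncols F))"
  by (simp add: row_abs_def shifted_row_label_def)

lemma shifted_row_label_eq:
  assumes "is_ferrers F" "r < ferrers_length F"
  shows "shifted_row_label F r = signed (south_labels F) (row_abs F r)"
proof (cases "r < ncols F")
  case True
  then show ?thesis using col_label_mem(2)[OF assms(1) True]
    by (simp add: row_abs_eq shifted_row_label_def signed_def)
next
  case False
  then have "row_label F (r - ncols F) \<in> south_labels F"
    using assms(2) by (auto simp: south_labels_def south_step_def ferrers_length_def intro!: exI[of _ "r - ncols F"])
  then show ?thesis using False by (simp add: row_abs_eq shifted_row_label_def signed_def)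
qed

text \<open>Column labels decrease to the right, so their negatives increase down the new rows; the
  positive labels below them increase as well. Being above in a column thus becomes an inequality
  between integers.\<close>

lemma shifted_row_label_strict_mono:
  assumes "is_ferrers F" "r < r'" "r' < ferrers_length F"
  shows "shifted_row_label F r < shifted_row_label F r'"
proof -
  consider "r' < ncols F" | "r < ncols F" "ncols F \<le> r'" | "ncols F \<le> r" by linarith
  then show ?thesis
  proof cases
    case 1
    then show ?thesis using col_label_strict_antimono[OF assms(2)] assms(2)
      by (simp add: shifted_row_label_def)
  next
    case 2
    then show ?thesis by (simp add: shifted_row_label_def row_label_def)
  next
    case 3
    then show ?thesis using assms row_label_strict_mono[OF assms(1), of "r - ncols F" "r' - ncols F"]
      by (simp add: shifted_row_label_def ferrers_length_def)
  qed
qed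

lemma shifted_row_label_less_iff:
  assumes "is_ferrers F" "r < ferrers_length F" "r' < ferrers_length F"
  shows "shifted_row_label F r < shifted_row_label F r' \<longleftrightarrow> r < r'"
  using shifted_row_label_strict_mono assms by (metis linorder_less_linear order_less_asym)

text \<open>The sign of a row label is determined by its absolute value through
  \<open>signed\<close>, so rows with equal absolute values have equal labels and hence coincide by
  strict monotonicity.\<close>

lemma row_abs_eq_iff:
  assumes "is_ferrers F" "r < ferrers_length F" "r' < ferrers_length F"
  shows "row_abs F r = row_abs F r' \<longleftrightarrow> r = r'"
  using shifted_row_label_less_iff[OF assms] shifted_row_label_less_iff[OF assms(1,3,2)]
    shifted_row_label_eq[OF assms(1,2)] shifted_row_label_eq[OF assms(1,3)]
  by (metis linorder_less_linear order_less_irrefl)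

lemma row_abs_image:
  assumes "is_ferrers F"
  shows "row_abs F ` {..<ferrers_length F} = {1..ferrers_length F}"
proof (rule card_subset_eq)
  show "row_abs F ` {..<ferrers_length F} \<subseteq> {1..ferrers_length F}"
  proof
    fix i assume "i \<in> row_abs F ` {..<ferrers_length F}"
    then obtain r where r: "r < ferrers_length F" "i = row_abs F r" by auto
    show "i \<in> {1..ferrers_length F}"
      using col_label_mem(1)[OF assms, of r] row_label_le[OF assms, of "r - ncols F"] r
      by (auto simp: row_abs_eq ferrers_length_def)
  qed
  show "card (row_abs F ` {..<ferrers_length F}) = card {1..ferrers_length F}"
    using row_abs_eq_iff[OF assms] by (subst card_image) (auto simp: inj_on_def)
qed auto

lemma row_abs_mem:
  assumes "is_ferrers F" "r < ferrers_length F"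
  shows "row_abs F r \<in> {1..ferrers_length F}"
  using row_abs_image[OF assms(1)] assms(2) by blast

lemma ex_row_abs:
  assumes "is_ferrers F" "i \<in> {1..ferrers_length F}"
  obtains r where "r < ferrers_length F" "row_abs F r = i"
  using row_abs_image[OF assms(1)] assms(2) by (metis imageE lessThan_iff)

text \<open>A new row \<open>r\<close> ends in its diagonal cell, in column \<open>r\<close>, and
  column labels decrease to the right: this gives the weak inequality, with equality on the
  diagonal. For an original row the inequality is strict, since no label belongs to both a row and a
  column of \<open>F\<close>.\<close>

lemma shifted_cells_iff:
  assumes "is_ferrers F"
  shows "(r, c) \<in> shifted_cells F \<longleftrightarrow>
    r < ferrers_length F \<and> c < ncols F \<and> row_abs F r \<le> col_label F c"
proof (cases "r < ncols F")
  case True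
  have "shifted_row_lens F ! r = Suc r"
    using True by (simp add: shifted_row_lens_def nth_append del: upt_Suc)
  moreover have "c < Suc r \<longleftrightarrow> c < ncols F \<and> col_label F r \<le> col_label F c"
    using col_label_less_iff[of c F r] True by (cases "c < ncols F") auto
  ultimately show ?thesis
    using True by (simp add: shifted_cells_def length_shifted_row_lens row_abs_eq)
next
  case False
  have "shifted_row_lens F ! r = row_lens F ! (r - ncols F)"
    using False by (simp add: shifted_row_lens_def nth_append del: upt_Suc)
  moreover have "c < row_lens F ! (r - ncols F) \<longleftrightarrow>
      c < ncols F \<and> row_label F (r - ncols F) \<le> col_label F c"
    if "r < ferrers_length F"
  proof -
    have r: "r - ncols F < nrows F" using that False by (auto simp: ferrers_length_def)
    show ?thesis
      using cell_iff_row_label_less[OF assms r] col_label_neq_row_label[OF assms r]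
        row_len_le_ncols[OF assms r] by (cases "c < ncols F") force+
  qed
  ultimately show ?thesis
    using False by (auto simp: shifted_cells_def length_shifted_row_lens row_abs_eq)
qed

section \<open>Encodings by a label set and a map\<close>

text \<open>The restriction to the cells makes the value \<open>undefined\<close> elsewhere, as the
  extensional function space in \<open>perm_tableaux_B\<close> demands.\<close>

definition fill :: "ferrers \<Rightarrow> (nat \<Rightarrow> nat) \<Rightarrow> nat \<times> nat \<Rightarrow> nat" where
  "fill F m = (\<lambda>(r, c) \<in> shifted_cells F. if row_abs F r = m (col_label F c) then 1 else 0)"

text \<open>The bound \<open>m j \<le> j\<close> says that row \<open>m j\<close> meets column
  \<open>j\<close>. Labels in \<open>S\<close> have no column, so a tableau says nothing about
  \<open>m\<close> there; requiring fixed points, and extensionality outside \<open>{1..n}\<close>,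
  makes \<open>m\<close> unique.\<close>

definition label_maps :: "nat \<Rightarrow> (nat set \<times> (nat \<Rightarrow> nat)) set" where
  "label_maps n = {(S, m). S \<subseteq> {1..n} \<and> m \<in> {1..n} \<rightarrow>\<^sub>E {1..n} \<and>
     (\<forall>j\<in>{1..n}. m j \<le> j) \<and> (\<forall>i\<in>S. m i = i)}"

definition idempotent_on :: "'a set \<Rightarrow> ('a \<Rightarrow> 'a) \<Rightarrow> bool" where
  "idempotent_on A m \<longleftrightarrow> (\<forall>j\<in>A. m (m j) = m j)"

text \<open>Condition (2) on tableaux: column \<open>j'\<close> lies left of column
  \<open>j\<close>, and \<open>m j' \<le> j\<close> says that the row of its \<open>1\<close> also
  meets column \<open>j\<close>. The \<open>1\<close> of column \<open>j\<close> must then not lie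
  above that row.\<close>

definition signed_condition :: "nat \<Rightarrow> nat set \<Rightarrow> (nat \<Rightarrow> nat) \<Rightarrow> bool" where
  "signed_condition n S m \<longleftrightarrow> (\<forall>j\<in>{1..n} - S. \<forall>j'\<in>{1..n} - S.
     j < j' \<and> m j' \<le> j \<longrightarrow> signed S (m j') \<le> signed S (m j))"

text \<open>Here \<open>j\<close> lies between the minimum and another element of the block of
  \<open>j'\<close>; the block of \<open>j\<close> may then not start before that of
  \<open>j'\<close>.\<close>

definition noncrossing_map :: "nat \<Rightarrow> (nat \<Rightarrow> nat) \<Rightarrow> bool" where
  "noncrossing_map n m \<longleftrightarrow> (\<forall>j\<in>{1..n}. \<forall>j'\<in>{1..n}. j < j' \<and> m j' \<le> j \<longrightarrow> m j' \<le> m j)"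

text \<open>The fixed points outside \<open>S\<close> are the minima of the blocks in
  \<open>X\<close>. No block may start before such a minimum and continue beyond it.\<close>

definition nonnested_map :: "nat \<Rightarrow> nat set \<Rightarrow> (nat \<Rightarrow> nat) \<Rightarrow> bool" where
  "nonnested_map n S m \<longleftrightarrow>
     (\<forall>i\<in>{1..n} - S. m i = i \<longrightarrow> (\<forall>j\<in>{1..n}. i < j \<longrightarrow> i \<le> m j))"

definition encodings :: "nat \<Rightarrow> (nat set \<times> (nat \<Rightarrow> nat)) set" where
  "encodings n = {(S, m) \<in> label_maps n. idempotent_on {1..n} m \<and> signed_condition n S m}"

lemma signed_inject:
  assumes "i \<ge> 1" "j \<ge> 1"
  shows "signed S i = signed S j \<longleftrightarrow> i = j"
  using assms by (auto simp: signed_def)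

text \<open>The order of signed labels reverses the usual one among labels outside \<open>S\<close>.
  Applying the signed condition with a fixed point outside \<open>S\<close> as the smaller index
  yields nonnesting. Conversely, noncrossing gives \<open>m j' \<le> m j\<close>, and if
  \<open>m j\<close> carries a negative sign, nonnesting at the fixed point \<open>m j\<close> turns
  this into equality.\<close>

lemma signed_condition_iff:
  assumes "(S, m) \<in> label_maps n" "idempotent_on {1..n} m"
  shows "signed_condition n S m \<longleftrightarrow> noncrossing_map n m \<and> nonnested_map n S m"
proof -
  have mem: "m j \<in> {1..n}" and le: "m j \<le> j" and idem: "m (m j) = m j" if "j \<in> {1..n}" for j
    using assms that by (auto simp: label_maps_def idempotent_on_def)
  have fix_S: "m i = i" if "i \<in> S" for i
    using assms(1) that by (auto simp: label_maps_def)
  show ?thesis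
  proof (intro iffI conjI)
    assume sc: "signed_condition n S m"
    show nn: "nonnested_map n S m"
      unfolding nonnested_map_def
    proof (intro ballI impI)
      fix i j assume i: "i \<in> {1..n} - S" "m i = i" and j: "j \<in> {1..n}" "i < j"
      show "i \<le> m j"
      proof (rule ccontr)
        assume *: "\<not> i \<le> m j"
        then have "j \<notin> S" using fix_S j by force
        then have "signed S (m j) \<le> signed S (m i)"
          using sc i j * unfolding signed_condition_def by (metis DiffI linorder_not_le order_less_imp_le)
        then show False using i * by (auto simp: signed_def split: if_splits)
      qed
    qed
    show "noncrossing_map n m"
      unfolding noncrossing_map_def
    proof (intro ballI impI)
      fix j j' assume j: "j \<in> {1..n}" "j' \<in> {1..n}" "j < j' \<and> m j' \<le> j"
      show "m j' \<le> m j"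
      proof (rule ccontr)
        assume *: "\<not> m j' \<le> m j"
        then have S: "j \<notin> S" "j' \<notin> S" using fix_S j by force+
        with sc j have "signed S (m j') \<le> signed S (m j)"
          unfolding signed_condition_def by blast
        \<comment> \<open>A positive label at \<open>m j'\<close> would exceed the signed label of
          the smaller number \<open>m j\<close>.\<close>
        with * have y: "m j' \<notin> S" by (auto simp: signed_def split: if_splits)
        \<comment> \<open>If \<open>m j' = j\<close>, idempotence gives \<open>m j = m j'\<close>,
          against the assumption.\<close>
        have "m j' < j" using * idem[OF j(2)] j(3) by (cases "m j' = j") auto
        with nn y j mem[OF j(2)] idem[OF j(2)] have "m j' \<le> m j"
          unfolding nonnested_map_def by blast
        with * show False by simp
      qed
    qed
  next
    assume *: "noncrossing_map n m \<and> nonnested_map n S m"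
    show "signed_condition n S m"
      unfolding signed_condition_def
    proof (intro ballI impI)
      fix j j' assume j: "j \<in> {1..n} - S" "j' \<in> {1..n} - S" "j < j' \<and> m j' \<le> j"
      then have x: "m j' \<le> m j" using * by (auto simp: noncrossing_map_def)
      show "signed S (m j') \<le> signed S (m j)"
      proof (cases "m j \<in> S")
        case True then show ?thesis using x by (auto simp: signed_def)
      next
        case False
        have "m j \<in> {1..n} - S" "m j < j'" "j' \<in> {1..n}"
          using mem[of j] le[of j] False j by auto
        then have "m j \<le> m j'"
          using * idem[of j] j(1) unfolding nonnested_map_def by blast
        with x show ?thesis by simp
      qed
    qed
  qed
qed

section \<open>The tableau conditions in terms of the map\<close>

lemma fill_eq:
  assumes "(r, c) \<in> shifted_cells F"
  shows "fill F m (r, c) = (if row_abs F r = m (col_label F c) then 1 else 0)"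
  using assms by (simp add: fill_def)

text \<open>Absolute row labels are a bijection onto \<open>{1..n}\<close>, so exactly one row
  carries \<open>m j\<close>; the bound \<open>m j \<le> j\<close> puts its cell inside the
  diagram.\<close>

lemma fill_column:
  assumes F: "is_ferrers F" "ferrers_length F = n"
    and m: "(south_labels F, m) \<in> label_maps n" and c: "c < ncols F"
  shows "\<exists>!r. (r, c) \<in> shifted_cells F \<and> fill F m (r, c) = 1"
proof -
  have "m (col_label F c) \<in> {1..n}" "m (col_label F c) \<le> col_label F c"
    using m col_label_mem[OF F(1) c] F(2) by (auto simp: label_maps_def)
  moreover from this obtain r where r: "r < n" "row_abs F r = m (col_label F c)"
    using ex_row_abs[OF F(1)] F(2) by metis
  ultimately have cell: "(r, c) \<in> shifted_cells F" using shifted_cells_iff[OF F(1)] F(2) c by simp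
  show ?thesis
  proof (intro ex1I[of _ r])
    show "(r, c) \<in> shifted_cells F \<and> fill F m (r, c) = 1"
      using cell r by (simp add: fill_eq)
  next
    fix q assume q: "(q, c) \<in> shifted_cells F \<and> fill F m (q, c) = 1"
    then have "row_abs F q = row_abs F r" using r by (auto simp: fill_eq split: if_splits)
    then show "q = r" using row_abs_eq_iff[OF F(1)] shifted_cells_iff[OF F(1)] q r(1) F(2) by blast
  qed
qed

text \<open>A forbidden \<open>0\<close> in \<open>(r, c)\<close> with a \<open>1\<close> in
  \<open>(r', c)\<close> above and in \<open>(r, c')\<close> to the left amounts to a violation for
  the labels \<open>j < j'\<close> of columns \<open>c\<close> and \<open>c'\<close>: row
  \<open>r'\<close> is labelled by \<open>m j\<close>, row \<open>r\<close> by \<open>m j'\<close>,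
  and signed labels order the rows.\<close>

lemma fill_restriction_iff:
  assumes F: "is_ferrers F" "ferrers_length F = n"
    and m: "(south_labels F, m) \<in> label_maps n"
  shows "(\<forall>(r, c) \<in> shifted_cells F. fill F m (r, c) = 0 \<longrightarrow>
        \<not> ((\<exists>r'<r. (r', c) \<in> shifted_cells F \<and> fill F m (r', c) = 1) \<and>
           (\<exists>c'<c. (r, c') \<in> shifted_cells F \<and> fill F m (r, c') = 1)))
    \<longleftrightarrow> signed_condition n (south_labels F) m" (is "?L \<longleftrightarrow> ?R")
proof
  assume L: ?L
  show ?R
    unfolding signed_condition_def
  proof (intro ballI impI)
    fix j j' assume j: "j \<in> {1..n} - south_labels F" "j' \<in> {1..n} - south_labels F"
      and jj: "j < j' \<and> m j' \<le> j"
    obtain c where c: "c < ncols F" "col_label F c = j" using ex_col_label[OF F(1)] F(2) j by blast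
    obtain c' where c': "c' < ncols F" "col_label F c' = j'"
      using ex_col_label[OF F(1)] F(2) j by blast
    have mem: "m j \<in> {1..n}" "m j' \<in> {1..n}" "m j \<le> j" using m j by (auto simp: label_maps_def)
    obtain r' where r': "r' < n" "row_abs F r' = m j" using ex_row_abs[OF F(1)] F(2) mem by metis
    obtain r where r: "r < n" "row_abs F r = m j'" using ex_row_abs[OF F(1)] F(2) mem by metis
    have cells: "(r, c) \<in> shifted_cells F" "(r', c) \<in> shifted_cells F" "(r, c') \<in> shifted_cells F"
      using shifted_cells_iff[OF F(1)] F(2) c c' r r' jj mem by auto
    have "c' < c" using col_label_less_iff c c' jj by blast
    show "signed (south_labels F) (m j') \<le> signed (south_labels F) (m j)"
    proof (rule ccontr)
      assume *: "\<not> ?thesis"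
      then have "shifted_row_label F r' < shifted_row_label F r"
        using shifted_row_label_eq[OF F(1)] F(2) r r' by simp
      then have "r' < r" using shifted_row_label_less_iff[OF F(1)] F(2) r r' by simp
      moreover have "fill F m (r, c) = 0" "fill F m (r', c) = 1" "fill F m (r, c') = 1"
        using cells r r' c c' * by (auto simp: fill_eq)
      ultimately show False using bspec[OF L cells(1)] cells \<open>c' < c\<close> by auto
    qed
  qed
next
  assume R: ?R
  have "False" if rc: "(r, c) \<in> shifted_cells F" "fill F m (r, c) = 0"
      and r': "r' < r" "(r', c) \<in> shifted_cells F" "fill F m (r', c) = 1"
      and c': "c' < c" "(r, c') \<in> shifted_cells F" "fill F m (r, c') = 1" for r c r' c'
  proof -
    have b: "r < n" "r' < n" "c < ncols F" "c' < ncols F" "row_abs F r \<le> col_label F c"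
      using rc r' c' shifted_cells_iff[OF F(1)] F(2) by auto
    have e: "row_abs F r' = m (col_label F c)" "row_abs F r = m (col_label F c')"
      using r'(3) c'(3) fill_eq[OF r'(2), of m] fill_eq[OF c'(2), of m] by (metis zero_neq_one)+
    have "col_label F c < col_label F c'" using col_label_strict_antimono[OF c'(1) b(3)] .
    moreover have "col_label F c \<in> {1..n} - south_labels F" "col_label F c' \<in> {1..n} - south_labels F"
      using col_label_mem[OF F(1)] b F(2) by auto
    ultimately have "signed (south_labels F) (row_abs F r) \<le> signed (south_labels F) (row_abs F r')"
      using R b e unfolding signed_condition_def by metis
    then show False
      using shifted_row_label_eq[OF F(1)] shifted_row_label_strict_mono[OF F(1) r'(1)] F(2) b by simp
  qed
  then show ?L by clarify blast
qed

text \<open>If the \<open>1\<close> of column \<open>j'\<close> lies in a new row, left of its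
  diagonal cell, then that diagonal cell is in column \<open>m j'\<close> and must hold the
  \<open>1\<close> of that column, which says \<open>m (m j') = m j'\<close>.\<close>

lemma fill_diagonal_iff:
  assumes F: "is_ferrers F" "ferrers_length F = n"
    and m: "(south_labels F, m) \<in> label_maps n"
  shows "(\<forall>(r, c) \<in> diagonal_cells F. fill F m (r, c) = 0 \<longrightarrow>
        \<not> (\<exists>c'<c. (r, c') \<in> shifted_cells F \<and> fill F m (r, c') = 1))
    \<longleftrightarrow> idempotent_on {1..n} m" (is "?L \<longleftrightarrow> ?R")
proof
  assume L: ?L
  show ?R
    unfolding idempotent_on_def
  proof
    fix j' assume j': "j' \<in> {1..n}"
    have mem: "m j' \<in> {1..n}" "m j' \<le> j'" using m j' by (auto simp: label_maps_def)
    have fix_S: "m i = i" if "i \<in> south_labels F" for i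
      using m that by (auto simp: label_maps_def)
    show "m (m j') = m j'"
    proof (rule ccontr)
      assume *: "\<not> ?thesis"
      \<comment> \<open>In the excluded cases \<open>m j'\<close> is a fixed point anyway, so the
        row is a new one and its diagonal cell is not in column \<open>j'\<close>.\<close>
      then have S: "m j' \<notin> south_labels F" "j' \<notin> south_labels F" and "m j' \<noteq> j'"
        using fix_S by auto
      then have less: "m j' < j'" using mem by simp
      obtain c where c: "c < ncols F" "col_label F c = m j'"
        using ex_col_label[OF F(1)] F(2) mem S by blast
      obtain c' where c': "c' < ncols F" "col_label F c' = j'"
        using ex_col_label[OF F(1)] F(2) j' S by blast
      have "c' < c" using col_label_less_iff[OF c(1) c'(1)] c c' less by simp
      have a: "row_abs F c = m j'" using c by (simp add: row_abs_eq)
      have "c < n" using c F(2) by (simp add: ferrers_length_def)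
      then have cells: "(c, c) \<in> shifted_cells F" "(c, c') \<in> shifted_cells F"
        using shifted_cells_iff[OF F(1)] a c c' F(2) less by auto
      then have "fill F m (c, c) = 0" "fill F m (c, c') = 1"
        using a c c' * by (auto simp: fill_eq)
      with L cells \<open>c' < c\<close> c(1) show False by (auto simp: diagonal_cells_def)
    qed
  qed
next
  assume R: ?R
  have "False" if r: "r < ncols F" "fill F m (r, r) = 0"
    and c': "c' < r" "(r, c') \<in> shifted_cells F" "fill F m (r, c') = 1" for r c'
  proof -
    have a: "row_abs F r = col_label F r" using r by (simp add: row_abs_eq)
    have "r < n" using r F(2) by (simp add: ferrers_length_def)
    then have "(r, r) \<in> shifted_cells F" using shifted_cells_iff[OF F(1)] a r F(2) by auto
    then have 1: "m (col_label F r) \<noteq> col_label F r" using r a by (auto simp: fill_eq)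
    have 2: "m (col_label F c') = col_label F r" using c' a by (auto simp: fill_eq split: if_splits)
    have "col_label F c' \<in> {1..n}" using col_label_mem[OF F(1)] c' r(1) F(2) by simp
    with R 1 2 show False unfolding idempotent_on_def by metis
  qed
  then show ?L by (auto simp: diagonal_cells_def)
qed

lemma fill_in_CT_B_iff:
  assumes F: "is_ferrers F" "ferrers_length F = n"
    and m: "(south_labels F, m) \<in> label_maps n"
  shows "(F, fill F m) \<in> CT_B n \<longleftrightarrow> (south_labels F, m) \<in> encodings n"
proof -
  have "fill F m \<in> shifted_cells F \<rightarrow>\<^sub>E {0, 1}"
    by (auto simp: fill_def split: if_splits)
  moreover have "\<forall>c<ncols F. \<exists>!r. (r, c) \<in> shifted_cells F \<and> fill F m (r, c) = 1"
    using fill_column[OF assms] by blast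
  moreover from this have "\<forall>c<ncols F. \<exists>r. (r, c) \<in> shifted_cells F \<and> fill F m (r, c) = 1"
    by blast
  ultimately show ?thesis
    using F m
    unfolding CT_B_def perm_tableaux_B_def encodings_def mem_Collect_eq prod.case
      fill_restriction_iff[OF assms] fill_diagonal_iff[OF assms] by blast
qed

text \<open>The map is read off from the position of the unique \<open>1\<close> in each column.
  Both fillings are \<open>0\<close>-\<open>1\<close> valued, so it suffices that their ones
  agree.\<close>

lemma CT_B_fill:
  assumes T: "(F, t) \<in> CT_B n"
  obtains m where "(south_labels F, m) \<in> label_maps n" "t = fill F m"
proof -
  let ?S = "south_labels F"
  have F: "is_ferrers F" "ferrers_length F = n" and t: "t \<in> shifted_cells F \<rightarrow>\<^sub>E {0, 1}"
    and ex1: "\<And>c. c < ncols F \<Longrightarrow> \<exists>!r. (r, c) \<in> shifted_cells F \<and> t (r, c) = 1"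
    using T by (auto simp: CT_B_def perm_tableaux_B_def)
  \<comment> \<open>\<open>R c\<close> is the row of the \<open>1\<close> in column
    \<open>c\<close>, and \<open>C\<close> inverts the column labelling.\<close>
  define R where "R c = (THE r. (r, c) \<in> shifted_cells F \<and> t (r, c) = 1)" for c
  have R: "(r, c) \<in> shifted_cells F \<and> t (r, c) = 1 \<longleftrightarrow> r = R c" if "c < ncols F" for r c
    using theI'[OF ex1[OF that]] ex1[OF that] unfolding R_def by blast
  define C where "C j = (THE c. c < ncols F \<and> col_label F c = j)" for j
  have C: "C (col_label F c) = c" if "c < ncols F" for c
    unfolding C_def using that col_label_eq_iff by (intro the_equality) auto
  define m where "m = (\<lambda>j\<in>{1..n}. if j \<in> ?S then j else row_abs F (R (C j)))"
  have mc: "m (col_label F c) = row_abs F (R c)" if "c < ncols F" for c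
    using col_label_mem[OF F(1) that] F(2) C[OF that] by (simp add: m_def)
  have cell: "R c < n \<and> row_abs F (R c) \<le> col_label F c" if "c < ncols F" for c
    using R[OF that] shifted_cells_iff[OF F(1)] F(2) by blast
  have m: "m j \<in> {1..n} \<and> m j \<le> j" if j: "j \<in> {1..n}" for j
  proof (cases "j \<in> ?S")
    case True then show ?thesis using j by (simp add: m_def)
  next
    case False
    obtain c where c: "c < ncols F" "col_label F c = j"
      using ex_col_label[OF F(1)] F(2) j False by blast
    then show ?thesis using cell[OF c(1)] mc[OF c(1)] row_abs_mem[OF F(1)] F(2) by metis
  qed
  have "(?S, m) \<in> label_maps n"
    using m south_labels_subset[OF F(1)] F(2) by (auto simp: label_maps_def m_def)
  moreover have "t = fill F m"
  proof
    fix p :: "nat \<times> nat"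
    obtain r c where p: "p = (r, c)" by (cases p)
    show "t p = fill F m p"
    proof (cases "p \<in> shifted_cells F")
      case False
      then have "t p = undefined" using PiE_arb[OF t] by blast
      with False show ?thesis by (simp add: fill_def)
    next
      case True
      then have rc: "r < n" "c < ncols F" using shifted_cells_iff[OF F(1)] F(2) p by auto
      have "t p = 1 \<longleftrightarrow> r = R c" using R[OF rc(2)] True p by blast
      also have "\<dots> \<longleftrightarrow> row_abs F r = m (col_label F c)"
        using row_abs_eq_iff[OF F(1)] rc(1) cell[OF rc(2)] mc[OF rc(2)] F(2) by simp
      finally have "t p = 1 \<longleftrightarrow> fill F m p = 1" using True p by (simp add: fill_eq)
      moreover have "t p \<in> {0, 1}" "fill F m p \<in> {0, 1}"
        using PiE_mem[OF t True] True p by (auto simp: fill_eq)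
      ultimately show ?thesis by auto
    qed
  qed
  ultimately show ?thesis using that by blast
qed

section \<open>Encodings and tableaux with one \<open>1\<close> per column\<close>

text \<open>The description of \<open>nc_diagram\<close> with the set of south labels as its only
  data besides \<open>n\<close>, so that it can be used for an encoding that does not yet come from
  a partition.\<close>

definition diagram :: "nat \<Rightarrow> nat set \<Rightarrow> ferrers" where
  "diagram n S = (THE F. is_ferrers F \<and> ferrers_length F = n \<and>
     (\<forall>i\<in>{1..n}. south_step F i \<longleftrightarrow> i \<in> S))"

lemma diagram:
  assumes "S \<subseteq> {1..n}"
  shows "is_ferrers (diagram n S)" "ferrers_length (diagram n S) = n"
    "south_labels (diagram n S) = S"
proof -
  have *: "is_ferrers (diagram n S) \<and> ferrers_length (diagram n S) = n \<and>
     (\<forall>i\<in>{1..n}. south_step (diagram n S) i \<longleftrightarrow> i \<in> S)"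
    using theI'[OF ferrers_ex1[OF assms]] unfolding diagram_def .
  then show "is_ferrers (diagram n S)" "ferrers_length (diagram n S) = n" by auto
  with * show "south_labels (diagram n S) = S"
    using south_labels_subset[of "diagram n S"] assms by (auto simp: south_labels_def)
qed

lemma diagram_south_labels:
  assumes "is_ferrers F" "ferrers_length F = n"
  shows "diagram n (south_labels F) = F"
  unfolding diagram_def
proof (rule the1_equality)
  show "\<exists>!G. is_ferrers G \<and> ferrers_length G = n \<and>
      (\<forall>i\<in>{1..n}. south_step G i \<longleftrightarrow> i \<in> south_labels F)"
    using south_labels_subset[OF assms(1)] assms(2) by (intro ferrers_ex1) simp
qed (use assms in \<open>simp add: south_labels_def\<close>)

definition tableau_of :: "nat \<Rightarrow> nat set \<times> (nat \<Rightarrow> nat) \<Rightarrow> tableau" where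
  "tableau_of n = (\<lambda>(S, m). (diagram n S, fill (diagram n S) m))"

text \<open>At column labels the \<open>1\<close> of the column determines the value; at all other
  arguments \<open>label_maps\<close> prescribes it.\<close>

lemma fill_inject:
  assumes F: "is_ferrers F" "ferrers_length F = n"
    and m: "(south_labels F, m) \<in> label_maps n" "(south_labels F, m') \<in> label_maps n"
    and eq: "fill F m = fill F m'"
  shows "m = m'"
proof
  fix j
  consider "j \<notin> {1..n}" | "j \<in> south_labels F" | "j \<in> {1..n}" "j \<notin> south_labels F" by blast
  then show "m j = m' j"
  proof cases
    case 1
    then show ?thesis using m by (auto simp: label_maps_def PiE_def extensional_def)
  next
    case 2
    then show ?thesis using m by (auto simp: label_maps_def)
  next
    case 3
    then obtain c where c: "c < ncols F" "col_label F c = j"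
      using ex_col_label[OF F(1)] F(2) by blast
    obtain r where r: "(r, c) \<in> shifted_cells F" "fill F m (r, c) = 1"
      using fill_column[OF F m(1) c(1)] by blast
    with eq have "fill F m' (r, c) = 1" by simp
    with r c fill_eq[OF r(1)] show ?thesis by (metis zero_neq_one)
  qed
qed

lemma bij_betw_tableau_of: "bij_betw (tableau_of n) (encodings n) (CT_B n)"
  unfolding bij_betw_def
proof
  have sub: "S \<subseteq> {1..n}" "(S, m) \<in> label_maps n" if "(S, m) \<in> encodings n" for S m
    using that by (auto simp: encodings_def label_maps_def)
  show "inj_on (tableau_of n) (encodings n)"
  proof (rule inj_onI, clarify)
    fix S m S' m' assume *: "(S, m) \<in> encodings n" "(S', m') \<in> encodings n"
      "tableau_of n (S, m) = tableau_of n (S', m')"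
    note F = diagram[OF sub(1)[OF *(1)]]
    have eq: "diagram n S = diagram n S'" "fill (diagram n S) m = fill (diagram n S') m'"
      using *(3) by (auto simp: tableau_of_def)
    have "S = S'" using F(3) diagram(3)[OF sub(1)[OF *(2)]] unfolding eq(1) by (rule trans[OF sym])
    moreover have "m = m'"
    proof (rule fill_inject[OF F(1,2)])
      show "(south_labels (diagram n S), m) \<in> label_maps n" using sub(2)[OF *(1)] F(3) by simp
      show "(south_labels (diagram n S), m') \<in> label_maps n"
        using sub(2)[OF *(2)] F(3) \<open>S = S'\<close> by simp
      show "fill (diagram n S) m = fill (diagram n S) m'" using eq by simp
    qed
    ultimately show "S = S' \<and> m = m'" by blast
  qed
  show "tableau_of n ` encodings n = CT_B n"
  proof (intro equalityI subsetI)
    fix T assume "T \<in> tableau_of n ` encodings n"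
    then obtain S m where Sm: "(S, m) \<in> encodings n" "T = tableau_of n (S, m)" by auto
    then show "T \<in> CT_B n"
      using fill_in_CT_B_iff[of "diagram n S" n m] diagram[OF sub(1)] sub(2)
      by (simp add: tableau_of_def)
  next
    fix T assume T: "T \<in> CT_B n"
    obtain F t where Ft: "T = (F, t)" by (cases T)
    then have F: "is_ferrers F" "ferrers_length F = n"
      using T by (auto simp: CT_B_def perm_tableaux_B_def)
    obtain m where m: "(south_labels F, m) \<in> label_maps n" "t = fill F m"
      using CT_B_fill T Ft by blast
    then have "(south_labels F, m) \<in> encodings n" using fill_in_CT_B_iff[OF F] T Ft by simp
    moreover have "T = tableau_of n (south_labels F, m)"
      using m Ft diagram_south_labels[OF F] by (simp add: tableau_of_def)
    ultimately show "T \<in> tableau_of n ` encodings n" by blast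
  qed
qed


section \<open>Partitions with marked blocks as encodings\<close>

text \<open>In a partition the union is over a single block, so this names the block of
  \<open>i\<close> without a choice operator.\<close>

definition block_min :: "nat set set \<Rightarrow> nat \<Rightarrow> nat" where
  "block_min \<sigma> i = Min (\<Union>{B \<in> \<sigma>. i \<in> B})"

definition encode :: "nat \<Rightarrow> nat set set \<times> nat set set \<Rightarrow> nat set \<times> (nat \<Rightarrow> nat)" where
  "encode n = (\<lambda>(\<sigma>, X). (Min ` (\<sigma> - X), \<lambda>i\<in>{1..n}. block_min \<sigma> i))"

lemma partition_on_block:
  fixes n :: nat
  assumes "partition_on {1..n} \<sigma>" "B \<in> \<sigma>"
  shows "finite B" "B \<subseteq> {1..n}" "B \<noteq> {}" "Min B \<in> B" "Min B \<in> {1..n}"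
    and "\<And>i. i \<in> B \<Longrightarrow> Min B \<le> i"
proof -
  show sub: "B \<subseteq> {1..n}" and ne: "B \<noteq> {}" using assms by (auto simp: partition_on_def)
  show fin: "finite B" by (rule finite_subset[OF sub]) simp
  show "Min B \<in> B" using Min_in[OF fin ne] .
  then show "Min B \<in> {1..n}" using sub by blast
  show "\<And>i. i \<in> B \<Longrightarrow> Min B \<le> i" using fin by simp
qed

lemma partition_on_block_eq:
  assumes "partition_on A \<sigma>" "B \<in> \<sigma>" "C \<in> \<sigma>" "i \<in> B" "i \<in> C"
  shows "B = C"
  using assms by (auto simp: partition_on_def disjoint_def)

lemma partition_on_ex_block:
  assumes "partition_on A \<sigma>" "i \<in> A"
  obtains B where "B \<in> \<sigma>" "i \<in> B"
  using assms by (auto simp: partition_on_def)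

lemma block_min_eq:
  assumes "partition_on {1..n} \<sigma>" "B \<in> \<sigma>" "i \<in> B"
  shows "block_min \<sigma> i = Min B"
proof -
  have "{C \<in> \<sigma>. i \<in> C} = {B}" using partition_on_block_eq[OF assms(1)] assms(2,3) by blast
  then show ?thesis by (simp add: block_min_def)
qed

lemma Min_block_inject:
  fixes n :: nat
  assumes "partition_on {1..n} \<sigma>" "B \<in> \<sigma>" "C \<in> \<sigma>" "Min B = Min C"
  shows "B = C"
  using partition_on_block_eq[OF assms(1-3)] partition_on_block(4)[OF assms(1)] assms by metis

lemma block_eq_fibre:
  assumes "partition_on {1..n} \<sigma>" "B \<in> \<sigma>"
  shows "B = {j \<in> {1..n}. block_min \<sigma> j = Min B}"
proof (intro equalityI subsetI)
  fix j assume "j \<in> B"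
  then show "j \<in> {j \<in> {1..n}. block_min \<sigma> j = Min B}"
    using block_min_eq[OF assms] partition_on_block(2)[OF assms] by blast
next
  fix j assume j: "j \<in> {j \<in> {1..n}. block_min \<sigma> j = Min B}"
  then obtain C where C: "C \<in> \<sigma>" "j \<in> C" using partition_on_ex_block[OF assms(1)] by blast
  then have "Min C = Min B" using block_min_eq[OF assms(1)] j by simp
  then show "j \<in> B" using Min_block_inject[OF assms(1) C(1) assms(2)] C(2) by simp
qed

text \<open>Distinct blocks have distinct minima, so the blocks are the fibres of
  \<open>block_min\<close>. This recovers the partition from its encoding.\<close>

lemma partition_eq_fibres:
  assumes "partition_on {1..n} \<sigma>"
  shows "\<sigma> = (\<lambda>i. {j \<in> {1..n}. block_min \<sigma> j = block_min \<sigma> i}) ` {1..n}"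
proof (intro equalityI subsetI)
  fix B assume B: "B \<in> \<sigma>"
  note B' = partition_on_block(4,5)[OF assms B]
  have "B = {j \<in> {1..n}. block_min \<sigma> j = block_min \<sigma> (Min B)}"
    unfolding block_min_eq[OF assms B B'(1)] by (rule block_eq_fibre[OF assms B])
  then show "B \<in> (\<lambda>i. {j \<in> {1..n}. block_min \<sigma> j = block_min \<sigma> i}) ` {1..n}"
    using B'(2) by (rule image_eqI)
next
  fix B assume "B \<in> (\<lambda>i. {j \<in> {1..n}. block_min \<sigma> j = block_min \<sigma> i}) ` {1..n}"
  then obtain i where i: "i \<in> {1..n}" "B = {j \<in> {1..n}. block_min \<sigma> j = block_min \<sigma> i}" by blast
  obtain C where C: "C \<in> \<sigma>" "i \<in> C" using partition_on_ex_block[OF assms i(1)] .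
  have "B = C"
    unfolding i(2) block_min_eq[OF assms C] by (rule block_eq_fibre[OF assms C(1), symmetric])
  then show "B \<in> \<sigma>" using C(1) by simp
qed

lemma Min_in_south_iff:
  fixes n :: nat
  assumes "partition_on {1..n} \<sigma>" "X \<subseteq> \<sigma>" "B \<in> \<sigma>"
  shows "Min B \<in> Min ` (\<sigma> - X) \<longleftrightarrow> B \<notin> X"
proof
  assume "Min B \<in> Min ` (\<sigma> - X)"
  then obtain C where C: "C \<in> \<sigma>" "C \<notin> X" "Min B = Min C" by auto
  then have "B = C" using Min_block_inject[OF assms(1,3)] by blast
  with C(2) show "B \<notin> X" by simp
qed (use assms(3) in blast)

lemma marked_blocks_eq:
  fixes n :: nat
  assumes "partition_on {1..n} \<sigma>" "X \<subseteq> \<sigma>"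
  shows "X = {B \<in> \<sigma>. Min B \<notin> Min ` (\<sigma> - X)}"
  using Min_in_south_iff[OF assms] assms(2) by blast

lemma encode_in_label_maps:
  assumes "partition_on {1..n} \<sigma>"
  shows "encode n (\<sigma>, X) \<in> label_maps n" "idempotent_on {1..n} (snd (encode n (\<sigma>, X)))"
proof -
  have *: "block_min \<sigma> i \<in> {1..n} \<and> block_min \<sigma> i \<le> i \<and> block_min \<sigma> (block_min \<sigma> i) = block_min \<sigma> i"
    if i: "i \<in> {1..n}" for i
  proof -
    obtain B where B: "B \<in> \<sigma>" "i \<in> B" using partition_on_ex_block[OF assms i] .
    then show ?thesis using partition_on_block[OF assms B(1)] block_min_eq[OF assms B(1)] by simp
  qed
  have **: "Min B \<in> {1..n} \<and> block_min \<sigma> (Min B) = Min B" if "B \<in> \<sigma>" for B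
    using partition_on_block(4,5)[OF assms that] block_min_eq[OF assms that] by blast
  show "encode n (\<sigma>, X) \<in> label_maps n"
    using * ** by (auto simp: encode_def label_maps_def)
  show "idempotent_on {1..n} (snd (encode n (\<sigma>, X)))"
    using * by (auto simp: encode_def idempotent_on_def)
qed

lemma inj_on_encode: "inj_on (encode n) {(\<sigma>, X). partition_on {1..n} \<sigma> \<and> X \<subseteq> \<sigma>}"
proof (rule inj_onI, clarify)
  fix \<sigma> X \<sigma>' X'
  assume *: "partition_on {1..n} \<sigma>" "X \<subseteq> \<sigma>" "partition_on {1..n} \<sigma>'" "X' \<subseteq> \<sigma>'"
    "encode n (\<sigma>, X) = encode n (\<sigma>', X')"
  then have S: "Min ` (\<sigma> - X) = Min ` (\<sigma>' - X')"
    and "restrict (block_min \<sigma>) {1..n} = restrict (block_min \<sigma>') {1..n}"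
    by (simp_all add: encode_def)
  then have m: "block_min \<sigma> i = block_min \<sigma>' i" if "i \<in> {1..n}" for i
    using that by (metis restrict_apply')
  have "\<sigma> = (\<lambda>i. {j \<in> {1..n}. block_min \<sigma> j = block_min \<sigma> i}) ` {1..n}"
    by (rule partition_eq_fibres[OF *(1)])
  also have "\<dots> = (\<lambda>i. {j \<in> {1..n}. block_min \<sigma>' j = block_min \<sigma>' i}) ` {1..n}"
    using m by (intro image_cong) auto
  also have "\<dots> = \<sigma>'"
    by (rule partition_eq_fibres[OF *(3), symmetric])
  finally have "\<sigma> = \<sigma>'" .
  have "X = {B \<in> \<sigma>. Min B \<notin> Min ` (\<sigma> - X)}"
    by (rule marked_blocks_eq[OF *(1,2)])
  also have "\<dots> = {B \<in> \<sigma>'. Min B \<notin> Min ` (\<sigma>' - X')}"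
    unfolding S by (simp add: \<open>\<sigma> = \<sigma>'\<close>)
  also have "\<dots> = X'"
    by (rule marked_blocks_eq[OF *(3,4), symmetric])
  finally show "\<sigma> = \<sigma>' \<and> X = X'" using \<open>\<sigma> = \<sigma>'\<close> by blast
qed

text \<open>The blocks are the fibres of \<open>m\<close>. Idempotence puts \<open>m i\<close> into
  the fibre of \<open>i\<close>, and \<open>m j \<le> j\<close> makes it the minimum there.\<close>

lemma ex_encode:
  assumes Sm: "(S, m) \<in> label_maps n" "idempotent_on {1..n} m"
  obtains \<sigma> X where "partition_on {1..n} \<sigma>" "X \<subseteq> \<sigma>" "encode n (\<sigma>, X) = (S, m)"
proof -
  define fib where "fib i = {j \<in> {1..n}. m j = m i}" for i
  define \<sigma> where "\<sigma> = fib ` {1..n}"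
  define X where "X = {B \<in> \<sigma>. Min B \<notin> S}"
  have mem: "m j \<in> {1..n}" and le: "m j \<le> j" and idem: "m (m j) = m j" if "j \<in> {1..n}" for j
    using assms that by (auto simp: label_maps_def idempotent_on_def)
  have S: "S \<subseteq> {1..n}" and fix_S: "\<And>i. i \<in> S \<Longrightarrow> m i = i" and ext: "m \<in> extensional {1..n}"
    using Sm(1) by (auto simp: label_maps_def PiE_def)
  have Min_fib: "Min (fib i) = m i" if "i \<in> {1..n}" for i
  proof (rule Min_eqI)
    show "finite (fib i)" by (simp add: fib_def)
    show "m i \<le> j" if "j \<in> fib i" for j using that le[of j] by (simp add: fib_def)
    show "m i \<in> fib i" using that mem idem by (simp add: fib_def)
  qed
  have part: "partition_on {1..n} \<sigma>"
    by (rule partition_onI) (auto simp: \<sigma>_def fib_def disjnt_def)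
  have "Min ` (\<sigma> - X) = S"
  proof (intro equalityI subsetI)
    fix i assume "i \<in> Min ` (\<sigma> - X)" then show "i \<in> S" by (auto simp: X_def)
  next
    fix i assume i: "i \<in> S"
    \<comment> \<open>Elements of \<open>S\<close> are fixed by \<open>m\<close>, so each is the
      minimum of its own fibre.\<close>
    then have "fib i \<in> \<sigma>" "Min (fib i) = i" using S Min_fib fix_S by (auto simp: \<sigma>_def)
    moreover from this i have "fib i \<notin> X" by (simp add: X_def)
    ultimately show "i \<in> Min ` (\<sigma> - X)" by (metis DiffI image_eqI)
  qed
  moreover have "restrict (block_min \<sigma>) {1..n} = m"
  proof (rule extensionalityI[OF restrict_extensional ext])
    fix i assume i: "i \<in> {1..n}"
    then have "fib i \<in> \<sigma>" "i \<in> fib i" by (auto simp: \<sigma>_def fib_def)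
    then show "restrict (block_min \<sigma>) {1..n} i = m i"
      using i block_min_eq[OF part] Min_fib by simp
  qed
  ultimately have "encode n (\<sigma>, X) = (S, m)" by (simp add: encode_def)
  moreover have "X \<subseteq> \<sigma>" by (auto simp: X_def)
  ultimately show ?thesis using that part by blast
qed

section \<open>Noncrossing and nonnesting through block minima\<close>

text \<open>The edge joins the largest element of \<open>B\<close> below \<open>q\<close> to the
  smallest one above \<open>q\<close>.\<close>

lemma ex_straddling_edge:
  assumes "B \<in> \<sigma>" "finite B" "p \<in> B" "r \<in> B" "p < q" "q < r" "q \<notin> B"
  obtains a b where "edge \<sigma> a b" "a \<in> B" "b \<in> B" "p \<le> a" "a < q" "q < b" "b \<le> r"
proof -
  define L U where "L = {e \<in> B. e < q}" and "U = {e \<in> B. q < e}"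
  have fin: "finite L" "finite U" and mem: "p \<in> L" "r \<in> U"
    using assms by (auto simp: L_def U_def)
  have "Max L \<in> L" "Min U \<in> U" using Max_in[OF fin(1)] Min_in[OF fin(2)] mem by blast+
  then have 1: "Max L \<in> B" "Max L < q" "Min U \<in> B" "q < Min U" by (auto simp: L_def U_def)
  have 2: "p \<le> Max L" "Min U \<le> r" using fin mem by auto
  have "\<not> (Max L < l \<and> l < Min U)" if "l \<in> B" for l
  proof -
    consider "l \<in> L" | "l \<in> U" using \<open>l \<in> B\<close> assms(7) unfolding L_def U_def by (metis linorder_neqE_nat mem_Collect_eq)
    then show ?thesis
    proof cases
      case 1 then show ?thesis using Max_ge[OF fin(1)] by (meson linorder_not_less)
    next
      case 2 then show ?thesis using Min_le[OF fin(2)] by (meson linorder_not_less)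
    qed
  qed
  then have "edge \<sigma> (Max L) (Min U)" using 1 assms(1) by (auto simp: edge_def)
  then show ?thesis using that 1 2 by blast
qed

text \<open>A violation has the shape \<open>Min B < Min C < j < j'\<close> with \<open>j\<close> in
  \<open>B\<close> and \<open>j'\<close> in \<open>C\<close>; an edge of \<open>B\<close> over
  \<open>Min C\<close> and an edge of \<open>C\<close> over its right end then cross. Conversely,
  for crossing edges the map condition at the pairs \<open>(b, d)\<close> and \<open>(c, b)\<close>
  gives both inequalities between the two block minima.\<close>

lemma NC_iff_noncrossing_map:
  assumes part: "partition_on {1..n} \<sigma>"
  shows "\<sigma> \<in> NC n \<longleftrightarrow> noncrossing_map n (block_min \<sigma>)"
proof
  assume NC: "\<sigma> \<in> NC n"
  show "noncrossing_map n (block_min \<sigma>)"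
    unfolding noncrossing_map_def
  proof (intro ballI impI)
    fix j j' assume j: "j \<in> {1..n}" "j' \<in> {1..n}" "j < j' \<and> block_min \<sigma> j' \<le> j"
    obtain B where B: "B \<in> \<sigma>" "j \<in> B" using partition_on_ex_block[OF part j(1)] .
    obtain C where C: "C \<in> \<sigma>" "j' \<in> C" using partition_on_ex_block[OF part j(2)] .
    note B' = partition_on_block[OF part B(1)] block_min_eq[OF part B]
    note C' = partition_on_block[OF part C(1)] block_min_eq[OF part C]
    show "block_min \<sigma> j' \<le> block_min \<sigma> j"
    proof (rule ccontr)
      assume *: "\<not> ?thesis"
      then have "B \<noteq> C" using B'(7) C'(7) by auto
      then have disj: "x \<notin> C" if "x \<in> B" for x
        using partition_on_block_eq[OF part B(1) C(1)] that by blast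
      have "Min B < Min C" using * B'(7) C'(7) by linarith
      moreover have "Min C < j" using j(3) C' disj[OF B(2)] by (metis le_neq_implies_less)
      moreover have "Min C \<notin> B" using disj C'(4) by blast
      ultimately obtain a b where ab: "edge \<sigma> a b" "b \<in> B" "a < Min C" "Min C < b" "b \<le> j"
        using ex_straddling_edge[OF B(1) B'(1,4) B(2)] by metis
      moreover have "b < j'" using ab j by simp
      ultimately obtain c d where "edge \<sigma> c d" "Min C \<le> c" "c < b" "b < d"
        using ex_straddling_edge[OF C(1) C'(1,4) C(2)] disj by metis
      with ab have "a < c" by simp
      with ab \<open>edge \<sigma> c d\<close> \<open>c < b\<close> \<open>b < d\<close>
      have "edge \<sigma> a b \<and> edge \<sigma> c d \<and> a < c \<and> c < b \<and> b < d" by simp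
      with NC show False unfolding NC_def by blast
    qed
  qed
next
  assume nc: "noncrossing_map n (block_min \<sigma>)"
  have "False" if e: "edge \<sigma> a b" "edge \<sigma> c d" "a < c" "c < b" "b < d" for a b c d
  proof -
    obtain B where B: "B \<in> \<sigma>" "a \<in> B" "b \<in> B" "\<forall>l\<in>B. \<not> (a < l \<and> l < b)"
      using e(1) by (auto simp: edge_def)
    obtain C where C: "C \<in> \<sigma>" "c \<in> C" "d \<in> C" using e(2) by (auto simp: edge_def)
    note B' = partition_on_block[OF part B(1)] block_min_eq[OF part B(1)]
    note C' = partition_on_block[OF part C(1)] block_min_eq[OF part C(1)]
    \<comment> \<open>The edge \<open>(a, b)\<close> has no element of its block strictly inside,
      but \<open>c\<close> lies there.\<close>
    have "B \<noteq> C" using B C e by blast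
    then have "Min B \<noteq> Min C" using Min_block_inject[OF part B(1) C(1)] by blast
    moreover have "Min C \<le> Min B"
    proof -
      have "b \<in> {1..n}" "d \<in> {1..n}" "Min C \<le> b" using B C B'(2) C'(2) C'(6)[OF C(2)] e by auto
      then show ?thesis using nc e(5) B'(7)[OF B(3)] C'(7)[OF C(3)]
        unfolding noncrossing_map_def by metis
    qed
    moreover have "Min B \<le> Min C"
    proof -
      have "b \<in> {1..n}" "c \<in> {1..n}" "Min B \<le> c" using B C B'(2) C'(2) B'(6)[OF B(2)] e by auto
      then show ?thesis using nc e(4) B'(7)[OF B(3)] C'(7)[OF C(2)]
        unfolding noncrossing_map_def by metis
    qed
    ultimately show False by simp
  qed
  then show "\<sigma> \<in> NC n" using part by (auto simp: NC_def)
qed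

text \<open>If a block starts before \<open>Min B\<close> and continues past it, one of its edges
  passes over \<open>Min B\<close>, and noncrossing forces this edge to enclose all of
  \<open>B\<close>. Conversely, the block of an enclosing edge starts before \<open>Min B\<close>
  and has an element beyond it.\<close>

lemma nonnested_iff:
  assumes part: "partition_on {1..n} \<sigma>" and nc: "noncrossing_map n (block_min \<sigma>)" and B: "B \<in> \<sigma>"
  shows "nonnested \<sigma> B \<longleftrightarrow> (\<forall>j\<in>{1..n}. Min B < j \<longrightarrow> Min B \<le> block_min \<sigma> j)"
proof
  note B' = partition_on_block[OF part B] block_min_eq[OF part B]
  assume nn: "nonnested \<sigma> B"
  show "\<forall>j\<in>{1..n}. Min B < j \<longrightarrow> Min B \<le> block_min \<sigma> j"
  proof (intro ballI impI, rule ccontr)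
    fix j assume j: "j \<in> {1..n}" "Min B < j" and *: "\<not> Min B \<le> block_min \<sigma> j"
    obtain C where C: "C \<in> \<sigma>" "j \<in> C" using partition_on_ex_block[OF part j(1)] .
    note C' = partition_on_block[OF part C(1)] block_min_eq[OF part C(1)]
    have "Min C < Min B" using * C'(7)[OF C(2)] by simp
    then have disj: "x \<notin> C" if "x \<in> B" for x
      using partition_on_block_eq[OF part B C(1) that] by auto
    obtain a b where ab: "edge \<sigma> a b" "a \<in> C" "b \<in> C" "a < Min B" "Min B < b"
      using ex_straddling_edge[OF C(1) C'(1,4) C(2) \<open>Min C < Min B\<close> j(2) disj[OF B'(4)]] by metis
    have Max: "Max B \<in> B" using Max_in[OF B'(1,3)] .
    have "Max B < b"
    proof (rule ccontr)
      assume "\<not> Max B < b"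
      \<comment> \<open>Now \<open>b\<close> lies between \<open>Min B\<close> and
        \<open>Max B\<close>, so noncrossing forbids its block \<open>C\<close> to start before
        \<open>B\<close>.\<close>
      then have "b < Max B" using disj[OF Max] ab(3) by (metis linorder_neqE_nat)
      moreover have "b \<in> {1..n}" "Max B \<in> {1..n}" using ab(3) C'(2) Max B'(2) by auto
      ultimately have "Min B \<le> Min C"
        using nc ab(5) B'(7)[OF Max] C'(7)[OF ab(3)] unfolding noncrossing_map_def
        by (metis less_imp_le_nat)
      with \<open>Min C < Min B\<close> show False by simp
    qed
    with nn ab show False by (auto simp: nonnested_def)
  qed
next
  assume *: "\<forall>j\<in>{1..n}. Min B < j \<longrightarrow> Min B \<le> block_min \<sigma> j"
  have "False" if e: "edge \<sigma> a b" "a < Min B" "Max B < b" for a b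
  proof -
    obtain C where C: "C \<in> \<sigma>" "a \<in> C" "b \<in> C" using e(1) by (auto simp: edge_def)
    note C' = partition_on_block[OF part C(1)] block_min_eq[OF part C(1)]
    have "Min B \<le> Max B" using partition_on_block[OF part B] by simp
    then have "Min B \<le> Min C" using * C C'(2) C'(7)[OF C(3)] e(3) by (metis le_less_trans subsetD)
    with C'(6)[OF C(2)] e(2) show False by simp
  qed
  then show "nonnested \<sigma> B" by (auto simp: nonnested_def)
qed

text \<open>The fixed points of \<open>block_min\<close> outside the south labels are exactly the
  minima of blocks in \<open>X\<close>, so nonnesting of the map ranges over those blocks.\<close>

lemma NC_NN_iff:
  assumes part: "partition_on {1..n} \<sigma>" and X: "X \<subseteq> \<sigma>"
  shows "(\<sigma>, X) \<in> NC_NN n \<longleftrightarrow> encode n (\<sigma>, X) \<in> encodings n"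
proof -
  let ?S = "Min ` (\<sigma> - X)" and ?m = "restrict (block_min \<sigma>) {1..n}"
  have lm: "(?S, ?m) \<in> label_maps n" "idempotent_on {1..n} ?m"
    using encode_in_label_maps[OF part, of X] by (simp_all add: encode_def)
  have nc: "noncrossing_map n ?m \<longleftrightarrow> noncrossing_map n (block_min \<sigma>)"
    by (simp add: noncrossing_map_def)
  have "nonnested_map n ?S ?m \<longleftrightarrow>
      (\<forall>B\<in>X. \<forall>j\<in>{1..n}. Min B < j \<longrightarrow> Min B \<le> block_min \<sigma> j)" (is "?L \<longleftrightarrow> ?R")
  proof
    assume L: ?L
    show ?R
    proof
      fix B assume B: "B \<in> X"
      then have "B \<in> \<sigma>" using X by blast
      then have "Min B \<in> {1..n} - ?S" "?m (Min B) = Min B"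
        using partition_on_block(4,5)[OF part] Min_in_south_iff[OF part X] block_min_eq[OF part] B
        by auto
      with L have "\<forall>j\<in>{1..n}. Min B < j \<longrightarrow> Min B \<le> ?m j" unfolding nonnested_map_def by blast
      then show "\<forall>j\<in>{1..n}. Min B < j \<longrightarrow> Min B \<le> block_min \<sigma> j" by simp
    qed
  next
    assume R: ?R
    show ?L
      unfolding nonnested_map_def
    proof (intro ballI impI)
      fix i j assume i: "i \<in> {1..n} - ?S" "?m i = i" and j: "j \<in> {1..n}" "i < j"
      obtain B where B: "B \<in> \<sigma>" "i \<in> B" using partition_on_ex_block[OF part] i(1) by blast
      then have "Min B = i" using i block_min_eq[OF part B] by simp
      then have "B \<in> X" using Min_in_south_iff[OF part X B(1)] i(1) by simp
      with R j \<open>Min B = i\<close> show "i \<le> ?m j" by auto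
    qed
  qed
  moreover have "(\<sigma>, X) \<in> NC_NN n \<longleftrightarrow> \<sigma> \<in> NC n \<and> (\<forall>B\<in>X. nonnested \<sigma> B)"
    using X by (auto simp: NC_NN_def)
  moreover have "encode n (\<sigma>, X) = (?S, ?m)" by (simp add: encode_def)
  ultimately show ?thesis
    using lm signed_condition_iff[OF lm] nc NC_iff_noncrossing_map[OF part]
      nonnested_iff[OF part] X by (auto simp: encodings_def)
qed

lemma NC_NN_partition:
  assumes "(\<sigma>, X) \<in> NC_NN n"
  shows "partition_on {1..n} \<sigma>" "X \<subseteq> \<sigma>"
  using assms by (auto simp: NC_NN_def NC_def)

lemma bij_betw_encode: "bij_betw (encode n) (NC_NN n) (encodings n)"
  unfolding bij_betw_def
proof
  show "inj_on (encode n) (NC_NN n)"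
    by (rule inj_on_subset[OF inj_on_encode]) (use NC_NN_partition in blast)
  show "encode n ` NC_NN n = encodings n"
  proof (intro equalityI subsetI)
    fix p assume "p \<in> encode n ` NC_NN n"
    then obtain \<sigma> X where *: "(\<sigma>, X) \<in> NC_NN n" "p = encode n (\<sigma>, X)" by auto
    then show "p \<in> encodings n" using NC_NN_iff[OF NC_NN_partition[OF *(1)]] by simp
  next
    fix p assume p: "p \<in> encodings n"
    obtain S m where Sm: "p = (S, m)" by (cases p)
    with p have "(S, m) \<in> label_maps n" "idempotent_on {1..n} m" by (auto simp: encodings_def)
    then obtain \<sigma> X where *: "partition_on {1..n} \<sigma>" "X \<subseteq> \<sigma>" "encode n (\<sigma>, X) = (S, m)"
      by (rule ex_encode)
    with p Sm NC_NN_iff[OF *(1,2)] have "(\<sigma>, X) \<in> NC_NN n" by simp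
    with * Sm show "p \<in> encode n ` NC_NN n" by (metis imageI)
  qed
qed

section \<open>Factorization of the map through the encodings\<close>

text \<open>A column label can be the minimum of its block only if that block is in
  \<open>X\<close>. This case falls under the first clause and every other under the second; both
  name the row whose label is the signed block minimum.\<close>

lemma nc_one_entry_iff:
  assumes part: "partition_on {1..n} \<sigma>" and X: "X \<subseteq> \<sigma>"
    and j: "j \<in> {1..n}" "j \<notin> Min ` (\<sigma> - X)"
  shows "nc_one_entry \<sigma> X a j \<longleftrightarrow> a = signed (Min ` (\<sigma> - X)) (block_min \<sigma> j)"
proof -
  obtain B where B: "B \<in> \<sigma>" "j \<in> B" using partition_on_ex_block[OF part j(1)] .
  have uniq: "C = B" if "C \<in> \<sigma>" "j \<in> C" for C
    using partition_on_block_eq[OF part] B that by blast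
  have Min: "C = B" if "C \<in> X" "j = Min C" for C
    using uniq[of C] partition_on_block(4)[OF part, of C] X that by auto
  have "nc_one_entry \<sigma> X a j \<longleftrightarrow> B \<in> X \<and> j = Min B \<and> a = - int (Min B) \<or>
      j \<noteq> Min B \<and> a = (if B \<in> X then - int (Min B) else int (Min B))"
    unfolding nc_one_entry_def using uniq Min B by blast
  moreover have "j \<noteq> Min B" if "B \<notin> X" using that B(1) j(2) by blast
  ultimately show ?thesis
    using Min_in_south_iff[OF part X B(1)] block_min_eq[OF part B] by (auto simp: signed_def)
qed

lemma nc_to_tableau_eq:
  assumes part: "partition_on {1..n} \<sigma>" and X: "X \<subseteq> \<sigma>"
  shows "nc_to_tableau n (\<sigma>, X) = tableau_of n (encode n (\<sigma>, X))"
proof -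
  let ?S = "Min ` (\<sigma> - X)"
  let ?F = "diagram n ?S"
  have nc: "nc_diagram n \<sigma> X = ?F"
    unfolding nc_diagram_def diagram_def by (simp add: image_iff)
  have S: "?S \<subseteq> {1..n}" using partition_on_block(5)[OF part] by blast
  note F = diagram[OF S]
  have "nc_one_entry \<sigma> X (shifted_row_label ?F r) (col_label ?F c) \<longleftrightarrow>
      row_abs ?F r = restrict (block_min \<sigma>) {1..n} (col_label ?F c)"
    if "(r, c) \<in> shifted_cells ?F" for r c
  proof -
    have rc: "r < n" "c < ncols ?F" using that shifted_cells_iff[OF F(1)] F(2) by auto
    have j: "col_label ?F c \<in> {1..n}" "col_label ?F c \<notin> ?S"
      using col_label_mem[OF F(1) rc(2)] F(2,3) by auto
    obtain B where B: "B \<in> \<sigma>" "col_label ?F c \<in> B" using partition_on_ex_block[OF part j(1)] .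
    have "block_min \<sigma> (col_label ?F c) \<ge> 1"
      using block_min_eq[OF part B] partition_on_block(5)[OF part B(1)] by simp
    moreover have "row_abs ?F r \<ge> 1" using row_abs_mem[OF F(1)] rc(1) F(2) by simp
    ultimately show ?thesis
      using nc_one_entry_iff[OF part X j] shifted_row_label_eq[OF F(1)] rc(1) F(2,3) j(1)
      by (simp add: signed_inject)
  qed
  then show ?thesis
    by (auto simp: nc_to_tableau_def tableau_of_def encode_def nc fill_def Let_def intro!: restrict_ext)
qed

section \<open>Restriction to type D\<close>

lemma col_label_0:
  assumes "is_ferrers F" "ferrers_length F = n" "n \<ge> 1" "n \<notin> south_labels F"
  shows "0 < ncols F" "col_label F 0 = n"
proof -
  obtain c where c: "c < ncols F" "col_label F c = n"
    using ex_col_label[OF assms(1), of n] assms(2-4) by auto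
  then show "0 < ncols F" by simp
  then have "col_label F 0 \<le> n" using col_label_mem(1)[OF assms(1), of 0] assms(2) by simp
  moreover have "c = 0 \<or> col_label F c < col_label F 0" using col_label_strict_antimono c(1) by blast
  ultimately show "col_label F 0 = n" using c(2) by auto
qed

text \<open>If \<open>n\<close> is a south label, it is the largest row label and so belongs to the
  bottom row, which no column label can reach. Otherwise the leftmost column is labelled
  \<open>n\<close> and meets every row.\<close>

lemma last_row_nonempty_iff:
  assumes F: "is_ferrers F" "ferrers_length F = n" and n: "n \<ge> 1"
  shows "last (shifted_row_lens F) > 0 \<longleftrightarrow> n \<notin> south_labels F"
proof -
  have len: "length (shifted_row_lens F) = n" using F(2) by (simp add: length_shifted_row_lens)
  then have "last (shifted_row_lens F) = shifted_row_lens F ! (n - 1)"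
    using n by (subst last_conv_nth) auto
  then have "last (shifted_row_lens F) > 0 \<longleftrightarrow> (n - 1, 0) \<in> shifted_cells F"
    using n len by (simp add: shifted_cells_def)
  also have "\<dots> \<longleftrightarrow> 0 < ncols F \<and> row_abs F (n - 1) \<le> col_label F 0"
    using shifted_cells_iff[OF F(1)] F(2) n by simp
  also have "\<dots> \<longleftrightarrow> n \<notin> south_labels F"
  proof
    assume *: "0 < ncols F \<and> row_abs F (n - 1) \<le> col_label F 0"
    show "n \<notin> south_labels F"
    proof
      assume S: "n \<in> south_labels F"
      obtain r where r: "r < n" "row_abs F r = n" using ex_row_abs[OF F(1), of n] F(2) n by auto
      have "shifted_row_label F r = int n"
        using shifted_row_label_eq[OF F(1), of r] r F(2) S by (simp add: signed_def)
      moreover have "shifted_row_label F (n - 1) \<le> int n"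
        using shifted_row_label_eq[OF F(1), of "n - 1"] row_abs_mem[OF F(1), of "n - 1"] F(2) n
        by (auto simp: signed_def)
      ultimately have "\<not> r < n - 1"
        using shifted_row_label_strict_mono[OF F(1), of r "n - 1"] F(2) n by auto
      then have "r = n - 1" using r(1) by simp
      then have "n \<le> col_label F 0" using * r(2) by simp
      moreover have "col_label F 0 \<in> {1..n}" "col_label F 0 \<notin> south_labels F"
        using col_label_mem[OF F(1)] * F(2) by auto
      ultimately show False using S by auto
    qed
  next
    assume "n \<notin> south_labels F"
    from col_label_0[OF F n this]
    show "0 < ncols F \<and> row_abs F (n - 1) \<le> col_label F 0"
      using row_abs_mem[OF F(1), of "n - 1"] F(2) n by simp
  qed
  finally show ?thesis .
qed

text \<open>If \<open>n\<close> labels a column, that column is the leftmost one, and the top row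
  has absolute label \<open>n\<close> too. Its only cell thus holds a \<open>1\<close> iff
  \<open>m n = n\<close>.\<close>

lemma tableau_of_in_CT_D_iff:
  assumes p: "(S, m) \<in> encodings n" and n: "n \<ge> 1"
  shows "tableau_of n (S, m) \<in> CT_D n \<longleftrightarrow> n \<in> S \<or> m n \<noteq> n"
proof -
  have S: "S \<subseteq> {1..n}" using p by (auto simp: encodings_def label_maps_def)
  note F = diagram[OF S]
  let ?F = "diagram n S"
  have "tableau_of n (S, m) \<in> CT_B n"
    using bij_betw_apply[OF bij_betw_tableau_of p] .
  moreover have "shifted_row_lens ?F \<noteq> []"
    using length_shifted_row_lens[of ?F] F(2) n by auto
  moreover have "last (shifted_row_lens ?F) > 0 \<longleftrightarrow> n \<notin> S"
    using last_row_nonempty_iff[OF F(1,2) n] F(3) by simp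
  moreover have "fill ?F m (0, 0) = 1 \<longleftrightarrow> m n = n" if "n \<notin> S"
  proof -
    have c: "0 < ncols ?F" "col_label ?F 0 = n" using col_label_0[OF F(1,2) n] F(3) that by auto
    then have "row_abs ?F 0 = n" by (simp add: row_abs_eq)
    moreover from this have "(0, 0) \<in> shifted_cells ?F"
      using c n F(2) shifted_cells_iff[OF F(1)] by simp
    ultimately show ?thesis using c by (auto simp: fill_eq)
  qed
  ultimately show ?thesis by (auto simp: CT_D_def tableau_of_def)
qed

text \<open>As \<open>n\<close> is the largest element, its block is a singleton iff its minimum is
  \<open>n\<close>. Both conditions therefore say that \<open>{n}\<close> is not a block in
  \<open>X\<close>.\<close>

lemma NC_NN_bar_iff:
  assumes p: "(\<sigma>, X) \<in> NC_NN n" and n: "n \<ge> 1"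
  shows "(\<sigma>, X) \<in> NC_NN_bar n \<longleftrightarrow> n \<in> Min ` (\<sigma> - X) \<or> block_min \<sigma> n \<noteq> n"
proof -
  note part = NC_NN_partition[OF p]
  obtain B where B: "B \<in> \<sigma>" "n \<in> B" using partition_on_ex_block[OF part(1), of n] n by auto
  note B' = partition_on_block[OF part(1) B(1)]
  have m: "block_min \<sigma> n = Min B" using block_min_eq[OF part(1) B] .
  have uniq: "A = B" if "A \<in> X" "n \<in> A" for A
    using partition_on_block_eq[OF part(1)] B part(2) that by blast
  have "card B \<ge> 2 \<longleftrightarrow> Min B \<noteq> n"
  proof
    assume "card B \<ge> 2"
    then have "B \<noteq> {n}" by auto
    then obtain i where i: "i \<in> B" "i \<noteq> n" using B(2) by blast
    then show "Min B \<noteq> n" using B'(2) B'(6)[OF i(1)] by fastforce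
  next
    assume "Min B \<noteq> n"
    then have "card {Min B, n} = 2" by simp
    then show "card B \<ge> 2" using card_mono[OF B'(1), of "{Min B, n}"] B'(4) B(2) by simp
  qed
  moreover have "(\<sigma>, X) \<in> NC_NN_bar n \<longleftrightarrow> (B \<in> X \<longrightarrow> card B \<ge> 2)"
  proof -
    have "(\<sigma>, X) \<in> NC_NN_bar n \<longleftrightarrow> (\<forall>A\<in>X. n \<in> A \<longrightarrow> card A \<ge> 2)"
      using p by (simp add: NC_NN_bar_def)
    also have "\<dots> \<longleftrightarrow> (B \<in> X \<longrightarrow> card B \<ge> 2)"
      using uniq B(2) by metis
    finally show ?thesis .
  qed
  ultimately show ?thesis
    using m Min_in_south_iff[OF part B(1)] by auto
qed

theorem theorem8p3:
  fixes n :: nat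
  assumes "n \<ge> 2"
  shows "bij_betw (nc_to_tableau n) (NC_NN_bar n) (CT_D n)"
proof -
  have n: "n \<ge> 1" using assms by simp
  have eq: "nc_to_tableau n p = (tableau_of n \<circ> encode n) p" if "p \<in> NC_NN n" for p
    using that NC_NN_partition nc_to_tableau_eq by (cases p) auto
  have "bij_betw (tableau_of n \<circ> encode n) (NC_NN n) (CT_B n)"
    using bij_betw_trans[OF bij_betw_encode bij_betw_tableau_of] .
  then have bij: "bij_betw (nc_to_tableau n) (NC_NN n) (CT_B n)"
    using bij_betw_cong[of "NC_NN n"] eq by metis
  have iff: "nc_to_tableau n p \<in> CT_D n \<longleftrightarrow> p \<in> NC_NN_bar n" if p: "p \<in> NC_NN n" for p
  proof -
    obtain \<sigma> X where [simp]: "p = (\<sigma>, X)" by (cases p)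
    have "encode n p \<in> encodings n" using bij_betw_apply[OF bij_betw_encode p] .
    then show ?thesis
      using tableau_of_in_CT_D_iff[of "Min ` (\<sigma> - X)" "restrict (block_min \<sigma>) {1..n}"]
        NC_NN_bar_iff[of \<sigma> X n] eq[OF p] p n by (simp add: encode_def)
  qed
  \<comment> \<open>The domain is the full preimage of \<open>CT_D n\<close>, so the bijection onto
    \<open>CT_B n\<close> restricts to it with image \<open>CT_D n\<close>.\<close>
  have "NC_NN_bar n = {p \<in> NC_NN n. nc_to_tableau n p \<in> CT_D n}"
    using iff by (auto simp: NC_NN_bar_def)
  then have "nc_to_tableau n ` NC_NN_bar n = nc_to_tableau n ` NC_NN n \<inter> CT_D n"
    by (simp only:) blast
  also have "nc_to_tableau n ` NC_NN n = CT_B n" using bij by (rule bij_betw_imp_surj_on)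
  also have "CT_B n \<inter> CT_D n = CT_D n" by (auto simp: CT_D_def)
  finally show ?thesis
    by (intro bij_betw_subset[OF bij]) (auto simp: NC_NN_bar_def)
qed

end
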